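(* Let $p$ be a prime, let $\mathcal M$ be an arbitrary subset of $\mathbb F_p^*$ with $|\mathcal M|=M$ elements, and let $N$ be an integer with $2\leqslant N<p$. Let $\mathcal I=\{1,2,\ldots,N\}\pmod p\subset\mathbb F_p^*$ and $\mathcal I\cdot\mathcal M=\{xm:\ x\in\mathcal I,\ m\in\mathcal M\}\subset\mathbb F_p^*$. Then $$|\mathcal I\cdot\mathcal M|\gg \min\Bigl\{\frac{p}{\log^2 N},\ \frac{N^2}{\log^2 N},\ \frac{NM}{\log N}\Bigr\},$$ where the implied constant is absolute.
   Context: $|X|$ denotes the cardinality of a set $X$. $U\gg V$ means $U\geqslant cV$ for some absolute constant $c>0$. *)

theory Defs
  imports Complex_Main "HOL-Number_Theory.Number_Theory" "HOL-Algebra.Coset"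
begin

text \<open>
  \<open>\<F>\<^sub>p\<close> is \<^term>\<open>residue_ring (int p)\<close> rather than a type of cardinality \<open>p\<close>, so that an
  absolute constant can be quantified before \<open>p\<close>.
\<close>

definition residue_interval :: "nat \<Rightarrow> nat \<Rightarrow> int set" where
  "residue_interval p N = (\<lambda>n. int n mod int p) ` {1..N}"

end

theory Submission
  imports Defs "HOL-Analysis.Convex"
begin

text \<open>
  Replace the interval by the set \<open>Q\<close> of primes up to \<open>N\<close>, which has \<open>\<gg> N / log N\<close> elements, and
  apply Cauchy--Schwarz to the map \<open>(q, m) \<mapsto> q m\<close> on \<open>Q \<times> M\<close>. For \<open>m\<^sub>1 \<noteq> m\<^sub>2\<close>, two distinct solutions
  \<open>(q\<^sub>1, q\<^sub>2)\<close> of \<open>q\<^sub>1 m\<^sub>1 = q\<^sub>2 m\<^sub>2\<close> have a determinant which is divisible by \<open>p\<close> and, because the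
  entries are primes, nonzero. Hence those on one side of the diagonal have slopes in \<open>[0, 1]\<close> that
  are \<open>p / N\<^sup>2\<close>-separated, so that there are at most \<open>2 (N\<^sup>2 / p + 1)\<close> solutions.

  The lower bound for the number of primes comes from the Leibniz triangle: \<open>(n + 1) (n choose k)\<close>
  divides every common multiple of \<open>1, \<dots>, n + 1\<close>, and one such multiple is at most
  \<open>(n + 1)\<^sup>\<pi>\<^sup>(\<^sup>n\<^sup>+\<^sup>1\<^sup>)\<close>.
\<close>

section \<open>A Chebyshev lower bound\<close>

text \<open>The entries \<open>1 / (Suc n * (n choose k))\<close> of the Leibniz triangle satisfy a
  Pascal-type rule: two neighbours in a row add up to the entry above them. So if \<open>D\<close>
  times the left neighbour and \<open>D\<close> times the entry above are integers, then so is
  \<open>D\<close> times the right neighbour. The induction on \<open>k\<close> uses two different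
  rows, hence the generalisation over \<open>n\<close>.\<close>

lemma Suc_times_binomial_dvd_common_multiple:
  fixes D :: nat
  assumes "\<And>m. 1 \<le> m \<Longrightarrow> m \<le> Suc n \<Longrightarrow> m dvd D" and "k \<le> n"
  shows "Suc n * (n choose k) dvd D"
  using assms
proof (induction k arbitrary: n)
  case 0
  then show ?case by simp
next
  case (Suc k)
  then obtain m where n: "n = Suc m" and km: "k \<le> m"
    by (cases n) auto
  let ?a = "Suc n * (n choose k)" and ?b = "Suc n * (n choose Suc k)" and ?c = "Suc m * (m choose k)"
  have "?a dvd D" using Suc by simp
  then obtain u where u: "D = ?a * u" by blast
  have "?c dvd D" using Suc.IH[of m] Suc.prems n km by simp
  then obtain v where v: "D = ?c * v" by blast
  \<comment> \<open>Both neighbours are expressed through \<open>?c\<close>. Their reciprocals then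
    have the common denominator \<open>Suc n * ?c\<close> and numerators \<open>n - k\<close> and
    \<open>Suc k\<close>, which add up to \<open>Suc n\<close>.\<close>
  have c: "Suc k * (n choose Suc k) = ?c"
    using Suc_times_binomial[of k m] n by simp
  have c': "(n - k) * (n choose k) = ?c"
    using binomial_absorb_comp[of n k] n by simp
  have pos: "?a > 0" "?b > 0" "?c > 0" "n choose k > 0" "n choose Suc k > 0" using n km by simp_all
  have "n - k > 0" using n km by simp
  have ra: "1 / real ?a = real (n - k) / (real (Suc n) * real ?c)"
    unfolding c'[symmetric] of_nat_mult using pos(4) \<open>n - k > 0\<close> by (simp del: of_nat_Suc of_nat_diff)
  have rb: "1 / real ?b = real (Suc k) / (real (Suc n) * real ?c)"
    unfolding c[symmetric] of_nat_mult using pos(5) by (simp del: of_nat_Suc)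
  have "real (Suc n) = real (n - k) + real (Suc k)" using n km by simp
  then have "1 / real ?a + 1 / real ?b = 1 / real ?c"
    unfolding ra rb add_divide_distrib[symmetric]
    using pos(3) by (metis nonzero_divide_mult_cancel_left of_nat_0_eq_iff old.nat.distinct(2))
  then have "1 / real ?b = 1 / real ?c - 1 / real ?a" by linarith
  then have "real D * (1 / real ?b) = real D * (1 / real ?c - 1 / real ?a)" by (rule arg_cong)
  then have "real D / real ?b = real D / real ?c - real D / real ?a"
    unfolding right_diff_distrib times_divide_eq_right mult_1_right .
  also have "\<dots> = real v - real u"
  proof -
    have quot: "real (x * y) / real x = real y" if "x > 0" for x y :: nat
      using that by simp
    show ?thesis
      unfolding quot[OF pos(1), of u, folded u] quot[OF pos(3), of v, folded v] ..
  qed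
  finally have "real D = (real v - real u) * real ?b"
    by (rule nonzero_divide_eq_eq[THEN iffD1, rotated]) (use pos(2) in \<open>simp only: of_nat_eq_0_iff neq0_conv\<close>)
  \<comment> \<open>The quotient is read as an integer, since the difference of \<open>v\<close> and
    \<open>u\<close> would be truncated on naturals.\<close>
  then have "real_of_int (int D) = real_of_int ((int v - int u) * int ?b)"
    by (simp only: of_int_mult of_int_diff of_int_of_nat_eq)
  then have "int D = (int v - int u) * int ?b" by (simp only: of_int_eq_iff)
  then show ?case by (metis dvd_triv_right int_dvd_int_iff)
qed

text \<open>The witness is the least common multiple of \<open>1, ..., n\<close>, written as the
  product over primes \<open>q \<le> n\<close> of the largest power of \<open>q\<close> not
  exceeding \<open>n\<close>. Each factor is at most \<open>n\<close>, which bounds the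
  product.\<close>

lemma exists_common_multiple_le_power_primes:
  fixes n :: nat
  assumes "n > 0"
  obtains D :: nat where "D > 0" and "\<And>m. 1 \<le> m \<Longrightarrow> m \<le> n \<Longrightarrow> m dvd D"
    and "D \<le> n ^ card {q. prime q \<and> q \<le> n}"
proof -
  let ?Q = "{q. prime q \<and> q \<le> n}"
  have fin: "finite ?Q" by (rule finite_subset[of _ "{..n}"]) auto
  have "\<forall>q. prime q \<longrightarrow> (\<exists>e. q ^ e \<le> n \<and> n < q ^ (e + 1))"
    using ex_power_ivl1[of _ n] assms prime_ge_2_nat by simp
  then obtain e where e: "\<And>q. prime q \<Longrightarrow> q ^ e q \<le> n" "\<And>q. prime q \<Longrightarrow> n < q ^ (e q + 1)"
    by metis
  define D where "D = (\<Prod>q\<in>?Q. q ^ e q)"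
  show ?thesis
  proof (rule that[of D])
    show "D > 0" unfolding D_def by (rule prod_pos) (auto intro: prime_gt_0_nat)
    show "D \<le> n ^ card ?Q"
      unfolding D_def using prod_mono[of ?Q "\<lambda>q. q ^ e q" "\<lambda>_. n"] e(1) by simp
    show "m dvd D" if m: "1 \<le> m" "m \<le> n" for m
    proof -
      have "m = (\<Prod>q\<in>prime_factors m. q ^ multiplicity q m)"
        using prime_factorization_nat m by simp
      also have "\<dots> dvd D"
        unfolding D_def
      proof (rule prod_dvd_prod_subset2[OF fin])
        show "prime_factors m \<subseteq> ?Q" using m by (auto simp: in_prime_factors_iff dest!: dvd_imp_le)
        fix q assume "q \<in> prime_factors m"
        then have q: "prime q" by (simp add: in_prime_factors_iff)
        have "q ^ multiplicity q m \<le> m"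
          using m by (intro dvd_imp_le multiplicity_dvd) auto
        also have "m < q ^ (e q + 1)" using m e(2)[OF q] by simp
        finally have "multiplicity q m < e q + 1"
          using prime_gt_1_nat[OF q] by (simp only: power_strict_increasing_iff)
        then show "q ^ multiplicity q m dvd q ^ e q" by (simp add: le_imp_power_dvd)
      qed
      finally show ?thesis .
    qed
  qed
qed

text \<open>The \<open>n + 1\<close> entries of a row of Pascal's triangle sum to
  \<open>2 ^ n\<close>, and the central one is the largest.\<close>

lemma two_power_le_Suc_times_central_binomial: "2 ^ n \<le> Suc n * (n choose (n div 2))"
proof -
  have "2 ^ n = (\<Sum>k\<le>n. n choose k)" by (simp add: choose_row_sum)
  also have "\<dots> \<le> (\<Sum>k\<le>n. n choose (n div 2))" by (intro sum_mono binomial_maximum)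
  finally show ?thesis by simp
qed

lemma card_primes_ge:
  fixes N :: nat
  assumes "2 \<le> N"
  shows "real (card {q. prime q \<and> q \<le> N}) \<ge> ln 2 / 2 * (real N / ln (real N))"
proof -
  obtain D where D: "D > 0" "\<And>m. 1 \<le> m \<Longrightarrow> m \<le> N \<Longrightarrow> m dvd D"
    "D \<le> N ^ card {q. prime q \<and> q \<le> N}"
    using exists_common_multiple_le_power_primes[of N] assms by auto
  define n where "n = N - 1"
  have N: "N = Suc n" using assms n_def by simp
  have "2 ^ n \<le> Suc n * (n choose (n div 2))" by (rule two_power_le_Suc_times_central_binomial)
  also have "\<dots> \<le> D"
    by (rule dvd_imp_le[OF Suc_times_binomial_dvd_common_multiple D(1)]) (use D(2) N in auto)
  also note D(3)
  finally have "real (2 ^ n) \<le> real (N ^ card {q. prime q \<and> q \<le> N})" by (simp only: of_nat_le_iff)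
  then have "ln (2 ^ n :: real) \<le> ln (real N ^ card {q. prime q \<and> q \<le> N})"
    using assms by (simp add: ln_le_cancel_iff)
  then have le: "real n * ln 2 \<le> real (card {q. prime q \<and> q \<le> N}) * ln (real N)"
    using assms by (simp add: ln_realpow)
  \<comment> \<open>The \<open>1 / 2\<close> in the constant pays for replacing \<open>N - 1\<close>
    by \<open>N / 2\<close>.\<close>
  have "real N / 2 * ln 2 \<le> real n * ln 2" using N assms by (intro mult_right_mono) auto
  with le have "real N / 2 * ln 2 \<le> real (card {q. prime q \<and> q \<le> N}) * ln (real N)" by linarith
  then show ?thesis using assms by (simp add: field_simps)
qed

section \<open>Points with separated slopes\<close>

text \<open>Two slopes \<open>y / x\<close> differ by at least \<open>d / (x * x')\<close>, hence by
  at least \<open>d / N ^ 2\<close>. Scaling by \<open>T = N ^ 2 / d\<close> makes the gaps at least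
  1, so the floors are distinct; as the slopes lie in [0, 1], the floors lie between 0 and that of
  \<open>T\<close>.\<close>

lemma card_separated_slopes_below_diagonal:
  fixes A :: "(nat \<times> nat) set" and N :: nat and d :: real
  assumes d: "d > 0"
    and box: "\<And>x y. (x, y) \<in> A \<Longrightarrow> 1 \<le> x \<and> x \<le> N \<and> y \<le> x"
    and sep: "\<And>x y x' y'. (x, y) \<in> A \<Longrightarrow> (x', y') \<in> A \<Longrightarrow> (x, y) \<noteq> (x', y') \<Longrightarrow>
      d \<le> \<bar>real x * real y' - real x' * real y\<bar>"
  shows "real (card A) \<le> (real N)\<^sup>2 / d + 1"
proof -
  define T where "T = (real N)\<^sup>2 / d"
  have T0: "T \<ge> 0" using d T_def by simp
  define g where "g = (\<lambda>(x, y). nat \<lfloor>real y / real x * T\<rfloor>)"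
  have inj: "inj_on g A"
  proof (rule inj_onI, rule ccontr)
    fix a b assume ab: "a \<in> A" "b \<in> A" and eq: "g a = g b" and ne: "a \<noteq> b"
    obtain x y x' y' where a: "a = (x, y)" and b: "b = (x', y')" by (cases a, cases b)
    have x: "1 \<le> x" "x \<le> N" "1 \<le> x'" "x' \<le> N" using box ab a b by auto
    have "\<lfloor>real y / real x * T\<rfloor> = \<lfloor>real y' / real x' * T\<rfloor>"
      using eq T0 by (simp add: g_def a b eq_nat_nat_iff)
    then have "\<bar>real y' / real x' * T - real y / real x * T\<bar> < 1" by linarith
    moreover have "real y' / real x' * T - real y / real x * T
        = (real x * real y' - real x' * real y) / (real x * real x') * T"
      using x by (simp add: field_simps)
    ultimately have "\<bar>real x * real y' - real x' * real y\<bar> / (real x * real x') * T < 1"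
      using T0 by (simp add: abs_mult)
    then have "\<bar>real x * real y' - real x' * real y\<bar> * T < real x * real x'"
      using x by (simp add: field_simps)
    moreover have "d * T \<le> \<bar>real x * real y' - real x' * real y\<bar> * T"
      using sep[of x y x' y'] ab ne a b T0 by (intro mult_right_mono) auto
    moreover have "d * T = real N * real N" using d by (simp add: T_def power2_eq_square)
    moreover have "real x * real x' \<le> real N * real N" using x by (intro mult_mono) auto
    ultimately show False by linarith
  qed
  have "g ` A \<subseteq> {0..nat \<lfloor>T\<rfloor>}"
  proof
    fix z assume "z \<in> g ` A"
    then obtain x y where xy: "(x, y) \<in> A" and z: "z = nat \<lfloor>real y / real x * T\<rfloor>"
      by (auto simp: g_def)
    have "real y / real x * T \<le> 1 * T"
      using box[OF xy] T0 by (intro mult_right_mono) auto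
    then show "z \<in> {0..nat \<lfloor>T\<rfloor>}" using z by (simp add: floor_mono nat_mono)
  qed
  then have "card A \<le> card {0..nat \<lfloor>T\<rfloor>}"
    using card_inj_on_le[OF inj] by blast
  then have "real (card A) \<le> real (nat \<lfloor>T\<rfloor>) + 1" by simp
  also have "\<dots> \<le> T + 1" using T0 by simp
  finally show ?thesis by (simp add: T_def)
qed

text \<open>Points above the diagonal are reflected to points below it. The swap only changes the
  sign of the determinant, so the separation survives; counting diagonal points twice does no harm
  to an upper bound.\<close>

lemma card_separated_slopes:
  fixes A :: "(nat \<times> nat) set" and N :: nat and d :: real
  assumes d: "d > 0"
    and box: "A \<subseteq> {1..N} \<times> {1..N}"
    and sep: "\<And>x y x' y'. (x, y) \<in> A \<Longrightarrow> (x', y') \<in> A \<Longrightarrow> (x, y) \<noteq> (x', y') \<Longrightarrow>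
      d \<le> \<bar>real x * real y' - real x' * real y\<bar>"
  shows "real (card A) \<le> 2 * ((real N)\<^sup>2 / d + 1)"
proof -
  define B where "B = {(x, y). (x, y) \<in> A \<and> y \<le> x}"
  define C where "C = {(x, y). (y, x) \<in> A \<and> y \<le> x}"
  have "real (card B) \<le> (real N)\<^sup>2 / d + 1"
    by (rule card_separated_slopes_below_diagonal[OF d])
       (use box sep in \<open>auto simp: B_def\<close>)
  moreover have "real (card C) \<le> (real N)\<^sup>2 / d + 1"
  proof (rule card_separated_slopes_below_diagonal[OF d])
    fix x y assume "(x, y) \<in> C"
    then show "1 \<le> x \<and> x \<le> N \<and> y \<le> x" using box by (auto simp: C_def)
  next
    fix x y x' y' assume "(x, y) \<in> C" "(x', y') \<in> C" "(x, y) \<noteq> (x', y')"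
    then have "d \<le> \<bar>real y * real x' - real y' * real x\<bar>"
      using sep[of y x y' x'] by (auto simp: C_def)
    then show "d \<le> \<bar>real x * real y' - real x' * real y\<bar>"
      by (simp add: abs_minus_commute mult.commute)
  qed
  moreover have "card A \<le> card B + card C"
  proof -
    have "A \<subseteq> B \<union> prod.swap ` C" by (force simp: B_def C_def image_iff)
    moreover have "finite B" "finite (prod.swap ` C)"
      by (rule finite_subset[of _ "{1..N} \<times> {1..N}"]; use box in \<open>force simp: B_def C_def\<close>)+
    ultimately have "card A \<le> card (B \<union> prod.swap ` C)" by (intro card_mono) auto
    also have "\<dots> \<le> card B + card (prod.swap ` C)" by (rule card_Un_le)
    also have "card (prod.swap ` C) = card C" by (intro card_image) (auto simp: inj_on_def)
    finally show ?thesis by simp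
  qed
  ultimately show ?thesis by simp
qed

section \<open>Products of primes with residues\<close>

text \<open>Cauchy-Schwarz over the fibres of \<open>f\<close>: their sizes sum to
  \<open>card A\<close>, and the squares of their sizes sum to the number of collisions.\<close>

lemma card_square_le_card_image_times_collisions:
  assumes "finite A"
  shows "(real (card A))\<^sup>2 \<le> real (card (f ` A)) * real (card {(a, b) \<in> A \<times> A. f a = f b})"
proof -
  define F where "F y = {a \<in> A. f a = y}" for y
  have finF: "finite (F y)" for y using assms by (simp add: F_def)
  have "card A = card (\<Union>y\<in>f ` A. F y)" by (rule arg_cong[of _ _ card]) (auto simp: F_def)
  also have "\<dots> = (\<Sum>y\<in>f ` A. card (F y))"
    by (rule card_UN_disjoint) (use assms finF in \<open>auto simp: F_def\<close>)
  finally have 1: "real (card A) = (\<Sum>y\<in>f ` A. real (card (F y)))" by simp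
  have "card {(a, b) \<in> A \<times> A. f a = f b} = card (\<Union>y\<in>f ` A. F y \<times> F y)"
    by (rule arg_cong[of _ _ card]) (auto simp: F_def)
  also have "\<dots> = (\<Sum>y\<in>f ` A. card (F y \<times> F y))"
    by (rule card_UN_disjoint) (use assms finF in \<open>auto simp: F_def\<close>)
  finally have 2: "real (card {(a, b) \<in> A \<times> A. f a = f b}) = (\<Sum>y\<in>f ` A. (real (card (F y)))\<^sup>2)"
    by (simp add: power2_eq_square card_cartesian_product)
  show ?thesis
    unfolding 1 2 using sum_squared_le_sum_of_squares[of "\<lambda>y. real (card (F y))" "f ` A"]
    by (simp add: mult.commute)
qed

text \<open>Unique factorisation: \<open>q\<close> divides \<open>q' * r\<close> and differs from
  the prime \<open>r\<close>, so it equals \<open>q'\<close>. This makes the determinant of two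
  distinct solutions nonzero.\<close>

lemma prime_cross_products_eq_iff:
  fixes q r q' r' :: nat
  assumes "prime q" "prime r" "prime q'" "prime r'" "q \<noteq> r"
  shows "q * r' = q' * r \<longleftrightarrow> q = q' \<and> r = r'"
proof
  assume eq: "q * r' = q' * r"
  then have "q dvd q' * r" by (metis dvd_triv_left)
  then have "q = q'" using assms by (metis prime_dvd_multD primes_dvd_imp_eq)
  with eq assms(1) show "q = q' \<and> r = r'" by auto
qed auto

lemma not_dvd_of_residue:
  fixes p :: nat and m :: int
  assumes "m \<in> {1..int p - 1}"
  shows "\<not> int p dvd m"
  using assms zdvd_imp_le[of "int p" m] by auto

text \<open>The determinant of two distinct solutions is a nonzero multiple of \<open>p\<close>, so
  the solutions are separated with \<open>d = p\<close>.\<close>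

lemma card_prime_solutions_le:
  fixes p N :: nat and m\<^sub>1 m\<^sub>2 :: int
  assumes p: "prime p" "N < p" and m: "m\<^sub>1 \<in> {1..int p - 1}" "m\<^sub>2 \<in> {1..int p - 1}" "m\<^sub>1 \<noteq> m\<^sub>2"
  shows "real (card {(q, r). prime q \<and> q \<le> N \<and> prime r \<and> r \<le> N \<and>
      [int q * m\<^sub>1 = int r * m\<^sub>2] (mod int p)}) \<le> 2 * ((real N)\<^sup>2 / real p + 1)"
proof (rule card_separated_slopes)
  let ?A = "{(q, r). prime q \<and> q \<le> N \<and> prime r \<and> r \<le> N \<and> [int q * m\<^sub>1 = int r * m\<^sub>2] (mod int p)}"
  show "0 < real p" using p by simp
  show "?A \<subseteq> {1..N} \<times> {1..N}" by (auto simp: Suc_le_eq prime_gt_0_nat)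
  have pp: "prime (int p)" using p by simp
  have ndvd: "\<not> int p dvd m\<^sub>1" "\<not> int p dvd m\<^sub>2" using m not_dvd_of_residue by auto
  fix q r q' r' assume A: "(q, r) \<in> ?A" "(q', r') \<in> ?A" and ne: "(q, r) \<noteq> (q', r')"
  \<comment> \<open>A solution with \<open>q = r\<close> would make \<open>p\<close> divide
    \<open>q\<close> or \<open>m\<^sub>1 - m\<^sub>2\<close>, both nonzero and smaller than
    \<open>p\<close> in absolute value.\<close>
  have "q \<noteq> r"
  proof
    assume "q = r"
    with A have "int p dvd int q * (m\<^sub>1 - m\<^sub>2)" by (simp add: cong_iff_dvd_diff right_diff_distrib)
    moreover have "\<not> int p dvd int q"
      by (rule not_dvd_of_residue) (use A p prime_ge_1_nat in auto)
    ultimately have "int p dvd m\<^sub>1 - m\<^sub>2" using pp prime_dvd_multD by blast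
    then have "int p \<le> \<bar>m\<^sub>1 - m\<^sub>2\<bar>" using m dvd_imp_le_int[of "m\<^sub>1 - m\<^sub>2" "int p"] by simp
    with m show False by auto
  qed
  then have "int q * int r' - int q' * int r \<noteq> 0"
    using prime_cross_products_eq_iff[of q r q' r'] A ne
    by (metis (no_types, lifting) case_prodD mem_Collect_eq of_nat_eq_iff of_nat_mult right_minus_eq)
  moreover have "int p dvd int q * int r' - int q' * int r"
  proof -
    have "int p dvd int q * m\<^sub>1 - int r * m\<^sub>2" "int p dvd int q' * m\<^sub>1 - int r' * m\<^sub>2"
      using A by (auto simp: cong_iff_dvd_diff)
    \<comment> \<open>This combination eliminates \<open>m\<^sub>2\<close> and leaves the
      determinant times the invertible \<open>m\<^sub>1\<close>.\<close>
    then have "int p dvd int r' * (int q * m\<^sub>1 - int r * m\<^sub>2) - int r * (int q' * m\<^sub>1 - int r' * m\<^sub>2)"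
      by (rule dvd_diff[OF dvd_mult dvd_mult])
    also have "\<dots> = (int q * int r' - int q' * int r) * m\<^sub>1" by (simp add: algebra_simps)
    finally show ?thesis using pp ndvd prime_dvd_multD by blast
  qed
  ultimately have "int p \<le> \<bar>int q * int r' - int q' * int r\<bar>"
    using dvd_imp_le_int[of _ "int p"] by simp
  then have "real_of_int (int p) \<le> real_of_int \<bar>int q * int r' - int q' * int r\<bar>"
    by (simp only: of_int_le_iff)
  then show "real p \<le> \<bar>real q * real r' - real q' * real r\<bar>" by simp
qed

text \<open>Collisions with equal residues are trivial and number \<open>card Q * card M\<close>.
  The others are grouped by their pair of distinct residues: there are at most
  \<open>(card M) ^ 2\<close> such pairs, and each has boundedly many prime solutions in terms of
  \<open>N ^ 2 / p\<close>.\<close>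

lemma card_prime_collisions_le:
  fixes p N :: nat and M :: "int set"
  assumes p: "prime p" "N < p" and M: "M \<subseteq> {1..int p - 1}"
  defines "Q \<equiv> {q. prime q \<and> q \<le> N}"
  defines "f \<equiv> \<lambda>(q, m). int q * m mod int p"
  shows "real (card {(a, b) \<in> (Q \<times> M) \<times> (Q \<times> M). f a = f b}) \<le>
    real (card Q) * real (card M) + (real (card M))\<^sup>2 * (2 * ((real N)\<^sup>2 / real p + 1))"
proof -
  let ?K = "2 * ((real N)\<^sup>2 / real p + 1)"
  have finM: "finite M" using M finite_subset by blast
  have finQ: "finite Q" unfolding Q_def by (rule finite_subset[of _ "{..N}"]) auto
  define S where "S = (\<lambda>(m, m'). {(q, r). prime q \<and> q \<le> N \<and> prime r \<and> r \<le> N \<and>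
      [int q * m = int r * m'] (mod int p)})"
  define P where "P = {(m, m') \<in> M \<times> M. m \<noteq> m'}"
  define h :: "(int \<times> int) \<times> (nat \<times> nat) \<Rightarrow> (nat \<times> int) \<times> (nat \<times> int)"
    where "h = (\<lambda>((m, m'), (q, r)). ((q, m), (r, m')))"
  have finP: "finite P" unfolding P_def by (rule finite_subset[of _ "M \<times> M"]) (use finM in auto)
  have finS: "finite (S x)" for x
    by (rule finite_subset[of _ "{..N} \<times> {..N}"]) (auto simp: S_def split: prod.splits)
  have "{(a, b) \<in> (Q \<times> M) \<times> (Q \<times> M). f a = f b} \<subseteq> (\<lambda>a. (a, a)) ` (Q \<times> M) \<union> h ` Sigma P S"
  proof clarsimp
    fix q m r m'
    assume A: "q \<in> Q" "m \<in> M" "r \<in> Q" "m' \<in> M" and eq: "f (q, m) = f (r, m')"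
      and nin: "((q, m), (r, m')) \<notin> h ` Sigma P S"
    have cong: "[int q * m = int r * m'] (mod int p)" using eq by (simp add: f_def cong_def)
    have mm: "m = m'"
    proof (rule ccontr)
      assume "m \<noteq> m'"
      then have "((m, m'), (q, r)) \<in> Sigma P S" using A cong by (auto simp: P_def S_def Q_def)
      with nin show False by (force simp: h_def image_iff)
    qed
    have "coprime m (int p)"
      using not_dvd_of_residue[of m p] A M p by (metis coprime_commute prime_imp_coprime prime_nat_int_transfer subsetD)
    \<comment> \<open>Cancelling the invertible \<open>m\<close> leaves a congruence between primes
      that are at most \<open>N < p\<close>, hence an equality.\<close>
    then have "[int q = int r] (mod int p)" using cong mm by (simp add: cong_mult_rcancel)
    then have "q = r" using A p by (simp add: cong_def Q_def)
    with mm show "((q, m), (r, m')) \<in> (\<lambda>a. (a, a)) ` (Q \<times> M)" using A by auto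
  qed
  then have "card {(a, b) \<in> (Q \<times> M) \<times> (Q \<times> M). f a = f b}
      \<le> card ((\<lambda>a. (a, a)) ` (Q \<times> M) \<union> h ` Sigma P S)"
    by (rule card_mono[rotated]) (use finQ finM finP finS in auto)
  also have "\<dots> \<le> card ((\<lambda>a. (a, a)) ` (Q \<times> M)) + card (h ` Sigma P S)" by (rule card_Un_le)
  also have "\<dots> \<le> card (Q \<times> M) + card (Sigma P S)"
    using finQ finM finP finS by (intro add_mono card_image_le) auto
  also have "\<dots> = card Q * card M + (\<Sum>x\<in>P. card (S x))"
    using finP finS by (simp add: card_cartesian_product)
  finally have "real (card {(a, b) \<in> (Q \<times> M) \<times> (Q \<times> M). f a = f b})
      \<le> real (card Q * card M + (\<Sum>x\<in>P. card (S x)))"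
    by (simp only: of_nat_le_iff)
  then have le: "real (card {(a, b) \<in> (Q \<times> M) \<times> (Q \<times> M). f a = f b})
      \<le> real (card Q) * real (card M) + (\<Sum>x\<in>P. real (card (S x)))"
    by (simp only: of_nat_add of_nat_mult of_nat_sum)
  have "(\<Sum>x\<in>P. real (card (S x))) \<le> (\<Sum>x\<in>P. ?K)"
  proof (rule sum_mono)
    fix x assume "x \<in> P"
    then obtain m m' where x: "x = (m, m')" "m \<in> M" "m' \<in> M" "m \<noteq> m'" by (auto simp: P_def)
    then have "m \<in> {1..int p - 1}" "m' \<in> {1..int p - 1}" using M by auto
    from card_prime_solutions_le[OF p this x(4)] show "real (card (S x)) \<le> ?K"
      unfolding S_def x(1) prod.case .
  qed
  also have "\<dots> = real (card P) * ?K" by simp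
  also have "\<dots> \<le> real (card (M \<times> M)) * ?K"
  proof (rule mult_right_mono)
    have "card P \<le> card (M \<times> M)" by (rule card_mono) (use finM in \<open>auto simp: P_def\<close>)
    then show "real (card P) \<le> real (card (M \<times> M))" by simp
  qed simp
  also have "\<dots> = (real (card M))\<^sup>2 * ?K" by (simp add: card_cartesian_product power2_eq_square)
  finally show ?thesis using le by linarith
qed

lemma prime_multiples_subset_set_mult:
  fixes p N :: nat and M :: "int set"
  shows "(\<lambda>(q, m). int q * m mod int p) ` ({q. prime q \<and> q \<le> N} \<times> M)
    \<subseteq> residue_interval p N <#>\<^bsub>residue_ring (int p)\<^esub> M"
proof clarsimp
  fix q :: nat and m assume q: "prime q" "q \<le> N" and m: "m \<in> M"
  have "int q mod int p \<in> residue_interval p N"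
    using q prime_ge_1_nat[of q] by (auto simp: residue_interval_def)
  moreover have "int q * m mod int p = (int q mod int p) \<otimes>\<^bsub>residue_ring (int p)\<^esub> m"
    by (simp add: residue_ring_def mod_simps)
  ultimately show "int q * m mod int p \<in> residue_interval p N <#>\<^bsub>residue_ring (int p)\<^esub> M"
    using m unfolding set_mult_def by blast
qed

theorem theorem5:
  shows "\<exists>c::real. c > 0 \<and>
    (\<forall>(p::nat) (N::nat) (\<M>::int set).
       prime p \<longrightarrow> 2 \<le> N \<longrightarrow> N < p \<longrightarrow> \<M> \<subseteq> Units (residue_ring (int p)) \<longrightarrow>
       real (card (residue_interval p N <#>\<^bsub>residue_ring (int p)\<^esub> \<M>)) \<ge>
         c * Min {real p / (ln (real N))\<^sup>2,
                  (real N)\<^sup>2 / (ln (real N))\<^sup>2,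
                  real N * real (card \<M>) / ln (real N)})"
proof -
  define a :: real where "a = ln 2 / 2"
  have a: "0 < a" "a \<le> 1" using ln_2_less_1 by (auto simp: a_def)
  show ?thesis
  \<comment> \<open>Here \<open>a\<close> is the Chebyshev constant. The 8 is a factor 2 from
    keeping only the larger of the two collision terms, times a factor 4 from bounding
    \<open>K\<close> by the larger of its two summands.\<close>
  proof (intro exI[of _ "a\<^sup>2 / 8"] conjI allI impI)
    show "a\<^sup>2 / 8 > 0" using a by simp
    fix p N :: nat and M :: "int set"
    assume p: "prime p" and N: "2 \<le> N" "N < p" and MU: "M \<subseteq> Units (residue_ring (int p))"
    define L where "L = ln (real N)"
    define S where "S = real (card (residue_interval p N <#>\<^bsub>residue_ring (int p)\<^esub> M))"
    define Q where "Q = {q. prime q \<and> q \<le> N}"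
    define m where "m = real (card M)"
    define k where "k = real (card Q)"
    define K where "K = 2 * ((real N)\<^sup>2 / real p + 1)"
    define f where "f = (\<lambda>(q, m). int q * m mod int p)"
    have L: "L > 0" using N by (simp add: L_def)
    have p0: "real p > 0" using N by simp
    have k: "k \<ge> a * (real N / L)" using card_primes_ge[OF N(1)] by (simp add: k_def Q_def a_def L_def)
    then have k0: "k > 0" using a L N by (smt (verit) divide_pos_pos mult_pos_pos of_nat_0_less_iff zero_less_numeral less_le_trans)
    interpret R: residues_prime p "residue_ring (int p)" by unfold_locales (use p in auto)
    have M: "M \<subseteq> {1..int p - 1}" using MU R.res_prime_units_eq p0 by (simp add: of_nat_diff)
    have finM: "finite M" using M finite_subset by blast
    have finQ: "finite Q" unfolding Q_def by (rule finite_subset[of _ "{..N}"]) auto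
    have "card (f ` (Q \<times> M)) \<le> card (residue_interval p N <#>\<^bsub>residue_ring (int p)\<^esub> M)"
    proof (rule card_mono)
      show "finite (residue_interval p N <#>\<^bsub>residue_ring (int p)\<^esub> M)"
        unfolding set_mult_def residue_interval_def using finM by auto
      show "f ` (Q \<times> M) \<subseteq> residue_interval p N <#>\<^bsub>residue_ring (int p)\<^esub> M"
        unfolding f_def Q_def by (rule prime_multiples_subset_set_mult)
    qed
    then have fS: "real (card (f ` (Q \<times> M))) \<le> S" by (simp add: S_def)
    have S0: "S \<ge> 0" by (simp add: S_def)
    have "(k * m)\<^sup>2 \<le> real (card (f ` (Q \<times> M))) * real (card {(a, b) \<in> (Q \<times> M) \<times> (Q \<times> M). f a = f b})"
      using card_square_le_card_image_times_collisions[of "Q \<times> M" f] finQ finM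
      by (simp add: k_def m_def card_cartesian_product)
    also have "\<dots> \<le> S * (k * m + m\<^sup>2 * K)"
      using card_prime_collisions_le[OF p N(2) M] fS S0
      by (intro mult_mono) (simp_all add: f_def Q_def k_def m_def K_def)
    finally have CS: "(k * m)\<^sup>2 \<le> S * (k * m + m\<^sup>2 * K)" .
    let ?T = "{real p / L\<^sup>2, (real N)\<^sup>2 / L\<^sup>2, real N * m / L}"
    \<comment> \<open>Bounding \<open>S\<close> below by any one of the three entries suffices for
      the minimum. For empty \<open>M\<close> the third entry is 0.\<close>
    have "\<exists>t\<in>?T. a\<^sup>2 / 8 * t \<le> S"
    proof (cases "m = 0")
      case True
      then show ?thesis using S0 by simp
    next
      case False
      then have m0: "m > 0" by (simp add: m_def)
      have "m * (k\<^sup>2 * m) \<le> m * (S * (k + m * K))"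
        using CS by (simp add: power2_eq_square algebra_simps)
      then have CS': "k\<^sup>2 * m \<le> S * (k + m * K)" using m0 by simp
      show ?thesis
      \<comment> \<open>If the trivial collisions dominate, the image has size of order
        \<open>k * m\<close>, which gives the third entry. Otherwise
        \<open>k ^ 2 \<le> 2 * K * S\<close>, and the size of \<open>K\<close> decides between the
        first two.\<close>
      proof (cases "m * K \<le> k")
        case True
        have "k * (k * m) = k\<^sup>2 * m" by (simp add: power2_eq_square)
        also have "\<dots> \<le> S * (k + k)" using CS' True S0 by (smt (verit) mult_left_mono)
        also have "\<dots> = k * (2 * S)" by simp
        finally have kmS: "k * m \<le> 2 * S" using k0 by simp
        have aN: "a * (real N / L) * m \<le> k * m" using k m0 by (intro mult_right_mono) auto
        have "a\<^sup>2 / 8 * (real N * m / L) \<le> a / 2 * (real N * m / L)"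
        proof (rule mult_right_mono)
          \<comment> \<open>This case naturally yields the constant \<open>a / 2\<close>;
            \<open>a \<le> 1\<close> lets it be lowered to the common
            \<open>a\<^sup>2 / 8\<close>.\<close>
          have "a * a \<le> a * 1" using a by (intro mult_left_mono) auto
          then show "a\<^sup>2 / 8 \<le> a / 2" using a by (simp add: power2_eq_square)
        qed (use L m0 in simp)
        also have "\<dots> = a * (real N / L) * m / 2" by simp
        also have "\<dots> \<le> k * m / 2" by (rule divide_right_mono[OF aN]) simp
        also have "\<dots> \<le> S" using kmS by simp
        finally have "a\<^sup>2 / 8 * (real N * m / L) \<le> S" .
        then show ?thesis by blast
      next
        case False
        have "m * k\<^sup>2 \<le> S * (m * K + m * K)"
          using CS' False S0 by (smt (verit) mult_left_mono mult.commute)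
        also have "\<dots> = m * (2 * K * S)" by simp
        finally have kS: "k\<^sup>2 \<le> 2 * K * S" using m0 by simp
        have "(a * (real N / L))\<^sup>2 \<le> k\<^sup>2" using k a L by (intro power_mono) auto
        then have aS: "a\<^sup>2 * ((real N)\<^sup>2 / L\<^sup>2) \<le> 2 * K * S"
          using kS by (simp add: power_mult_distrib power_divide)
        show ?thesis
        \<comment> \<open>For \<open>N ^ 2 \<le> p\<close> the factor \<open>K\<close> is at most 4,
          giving the second entry. Otherwise it is at most \<open>4 * N ^ 2 / p\<close>, and the
          \<open>N ^ 2\<close> cancels to leave the first.\<close>
        proof (cases "(real N)\<^sup>2 \<le> real p")
          case True
          then have "K \<le> 4" using p0 by (simp add: K_def field_simps)
          then have "2 * K * S \<le> 8 * S" using S0 by (intro mult_right_mono) auto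
          then have "a\<^sup>2 / 8 * ((real N)\<^sup>2 / L\<^sup>2) \<le> S" using aS by simp
          then show ?thesis by blast
        next
          case False
          then have "K \<le> 4 * ((real N)\<^sup>2 / real p)" using p0 by (simp add: K_def field_simps)
          then have "2 * K * S \<le> 8 * ((real N)\<^sup>2 / real p) * S"
            using S0 by (intro mult_right_mono) auto
          then have "a\<^sup>2 * ((real N)\<^sup>2 / L\<^sup>2) \<le> 8 * ((real N)\<^sup>2 / real p) * S" using aS by linarith
          then have "(real N)\<^sup>2 * (a\<^sup>2 / L\<^sup>2) \<le> (real N)\<^sup>2 * (8 * S / real p)" by (simp add: mult_ac)
          then have "a\<^sup>2 / L\<^sup>2 \<le> 8 * S / real p" by (rule mult_left_le_imp_le) (use N in simp)
          then have "a\<^sup>2 / 8 * (real p / L\<^sup>2) \<le> S" using p0 L by (simp add: field_simps)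
          then show ?thesis by blast
        qed
      qed
    qed
    then obtain t where t: "t \<in> ?T" "a\<^sup>2 / 8 * t \<le> S" by blast
    have "a\<^sup>2 / 8 * Min ?T \<le> a\<^sup>2 / 8 * t" using t(1) by (intro mult_left_mono Min_le) auto
    with t(2) have "a\<^sup>2 / 8 * Min ?T \<le> S" by linarith
    then show "a\<^sup>2 / 8 * Min {real p / (ln (real N))\<^sup>2, (real N)\<^sup>2 / (ln (real N))\<^sup>2,
        real N * real (card M) / ln (real N)}
      \<le> real (card (residue_interval p N <#>\<^bsub>residue_ring (int p)\<^esub> M))"
      unfolding L_def S_def m_def .
  qed
qed

end
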